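(* Let $K=\{(\alpha,\beta,M)\in\mathbb{R}^2\times\mathbb{R}^2\times\mathbb{R}^{2\times2}: M=\alpha\otimes\beta+\Pi I\text{ for some }\Pi\in\mathbb{R}\}$ and let $K^\Lambda$ be its $\Lambda$-convex hull with respect to the wave cone $\Lambda$ of 2D ideal MHD. Whenever $\alpha,\beta\in\mathbb{R}^2$ and $N\in\mathbb{R}^{2\times2}$ satisfy $(\alpha,\beta,\alpha\otimes\beta+N)\in K^\Lambda$, the matrix $N$ is symmetric. In particular, $K^\Lambda$ has empty interior. However, $K^\Lambda\setminus K\neq\emptyset$.
   Context: $(v\otimes w)_{ij}=v_iw_j$. The wave cone $\Lambda$ is the set of $(\alpha,\beta,M)\in\mathbb{R}^2\times\mathbb{R}^2\times\mathbb{R}^{2\times2}$ for which there is $(\xi,c)\in(\mathbb{R}^2\setminus\{0\})\times\mathbb{R}$ with $M\xi+c\alpha=0$, $M^T\xi+c\beta=0$, $\alpha\cdot\xi=0$, $\beta\cdot\xi=0$. A function $f:\mathbb{R}^2\times\mathbb{R}^2\times\mathbb{R}^{2\times2}\to\mathbb{R}$ is $\Lambda$-convex if $t\mapsto f(V+tW)$ is convex on $\mathbb{R}$ for every $V$ and every $W\in\Lambda$. The $\Lambda$-convex hull $K^\Lambda$ is the set of points $W$ such that $f(W)\le0$ for every $\Lambda$-convex $f$ with $f|_K\le0$. Here $(\alpha,\beta,M)$ correspond to the Els\"asser variables $z^\pm=u\pm b$ of ideal MHD and their flux matrix. *)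

theory Defs
  imports "HOL-Analysis.Analysis"
begin

type_synonym mhd_state = "(real^2) \<times> (real^2) \<times> (real^2^2)"

definition tensor :: "real^2 \<Rightarrow> real^2 \<Rightarrow> real^2^2" (infixl "\<otimes>" 75)
  where "v \<otimes> w = (\<chi> i j. v $ i * w $ j)"

definition wave_cone :: "mhd_state set"
  where "wave_cone =
    {(\<alpha>, \<beta>, M). \<exists>\<xi>::real^2. \<exists>c::real. \<xi> \<noteq> 0 \<and>
       M *v \<xi> + c *\<^sub>R \<alpha> = 0 \<and> transpose M *v \<xi> + c *\<^sub>R \<beta> = 0 \<and>
       \<alpha> \<bullet> \<xi> = 0 \<and> \<beta> \<bullet> \<xi> = 0}"

definition Lambda_convex :: "(mhd_state \<Rightarrow> real) \<Rightarrow> bool"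
  where "Lambda_convex f \<longleftrightarrow>
    (\<forall>V. \<forall>W\<in>wave_cone. convex_on UNIV (\<lambda>t::real. f (V + t *\<^sub>R W)))"

definition Lambda_hull :: "mhd_state set \<Rightarrow> mhd_state set"
  where "Lambda_hull K =
    {W. \<forall>f. Lambda_convex f \<and> (\<forall>V\<in>K. f V \<le> 0) \<longrightarrow> f W \<le> 0}"

definition mhd_K :: "mhd_state set"
  where "mhd_K = {(\<alpha>, \<beta>, M). \<exists>p::real. M = \<alpha> \<otimes> \<beta> + p *\<^sub>R mat 1}"

end

theory Submission
  imports Defs
begin

text \<open>The skew part of \<open>M - \<alpha> \<otimes> \<beta>\<close> is affine along wave-cone directions, because the two vector
  components of such a direction are both orthogonal to \<open>\<xi>\<close>, hence parallel in the plane, which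
  kills the quadratic term \<open>\<alpha>\<^sub>1 \<beta>\<^sub>2 - \<alpha>\<^sub>2 \<beta>\<^sub>1\<close>. It vanishes on \<open>K\<close>, hence on the hull. On the
  other hand \<open>(e, e, e \<otimes> e)\<close> and \<open>(-e, -e, e \<otimes> e)\<close> lie in \<open>K\<close> and differ by a wave-cone
  direction, and their midpoint \<open>(0, 0, e \<otimes> e)\<close> is outside \<open>K\<close>.\<close>

text \<open>With \<open>N = M - \<alpha> \<otimes> \<beta>\<close> this is
  \<open>N $ 1 $ 2 - N $ 2 $ 1\<close>. Skew 2 by 2 matrices form a line, so one scalar detects
  symmetry.\<close>

definition skew_defect :: "mhd_state \<Rightarrow> real"
  where "skew_defect = (\<lambda>(\<alpha>, \<beta>, M).
    (M $ 1 $ 2 - M $ 2 $ 1) - (\<alpha> $ 1 * \<beta> $ 2 - \<alpha> $ 2 * \<beta> $ 1))"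

text \<open>A homogeneous 2 by 2 linear system with a nonzero solution has zero determinant.\<close>

lemma orthogonal_same_imp_parallel:
  fixes \<alpha> \<beta> \<xi> :: "real^2"
  assumes "\<xi> \<noteq> 0" "\<alpha> \<bullet> \<xi> = 0" "\<beta> \<bullet> \<xi> = 0"
  shows "\<alpha> $ 1 * \<beta> $ 2 = \<alpha> $ 2 * \<beta> $ 1"
proof -
  have a: "\<alpha> $ 1 * \<xi> $ 1 + \<alpha> $ 2 * \<xi> $ 2 = 0" and b: "\<beta> $ 1 * \<xi> $ 1 + \<beta> $ 2 * \<xi> $ 2 = 0"
    using assms(2,3) by (simp_all add: inner_vec_def sum_2)
  have "(\<alpha> $ 1 * \<beta> $ 2 - \<alpha> $ 2 * \<beta> $ 1) * \<xi> $ 1 = 0"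
    "(\<alpha> $ 1 * \<beta> $ 2 - \<alpha> $ 2 * \<beta> $ 1) * \<xi> $ 2 = 0"
    using a b by algebra+
  moreover have "\<xi> $ 1 \<noteq> 0 \<or> \<xi> $ 2 \<noteq> 0"
    using assms(1) by (auto simp: vec_eq_iff forall_2)
  ultimately show ?thesis by auto
qed

lemma skew_defect_affine_on_wave_cone:
  assumes "W \<in> wave_cone"
  shows "\<exists>b. \<forall>t. skew_defect (V + t *\<^sub>R W) = skew_defect V + t * b"
proof -
  obtain \<alpha> \<beta> M where V: "V = (\<alpha>, \<beta>, M)" by (cases V)
  obtain \<alpha>' \<beta>' M' where W: "W = (\<alpha>', \<beta>', M')" by (cases W)
  have par: "\<alpha>' $ 1 * \<beta>' $ 2 = \<alpha>' $ 2 * \<beta>' $ 1"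
    using assms orthogonal_same_imp_parallel by (auto simp: W wave_cone_def)
  \<comment> \<open>The slope collects the cross terms of \<open>V\<close> and \<open>W\<close>, so
    it depends on \<open>V\<close>; \<open>par\<close> removes the coefficient of
    \<open>t^2\<close>.\<close>
  have "skew_defect (V + t *\<^sub>R W) = skew_defect V + t * (M' $ 1 $ 2 - M' $ 2 $ 1
      - (\<alpha> $ 1 * \<beta>' $ 2 + \<alpha>' $ 1 * \<beta> $ 2 - \<alpha> $ 2 * \<beta>' $ 1 - \<alpha>' $ 2 * \<beta> $ 1))" for t
    unfolding skew_defect_def V W using par by (simp, algebra)
  then show ?thesis by blast
qed

lemma convex_on_affine: "convex_on UNIV (\<lambda>t::real. a + t * b :: real)"
  by (intro convex_onI) (auto simp: algebra_simps)

lemma Lambda_convex_skew_defect: "Lambda_convex skew_defect"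
  unfolding Lambda_convex_def
proof (intro allI ballI)
  fix V W assume "W \<in> wave_cone"
  then obtain b where "\<And>t. skew_defect (V + t *\<^sub>R W) = skew_defect V + t * b"
    using skew_defect_affine_on_wave_cone by blast
  then show "convex_on UNIV (\<lambda>t. skew_defect (V + t *\<^sub>R W))"
    by (simp add: convex_on_affine)
qed

text \<open>The hull only yields upper bounds; using both signs turns them into an equality.\<close>

lemma Lambda_convex_uminus_skew_defect: "Lambda_convex (\<lambda>V. - skew_defect V)"
  unfolding Lambda_convex_def
proof (intro allI ballI)
  fix V W assume "W \<in> wave_cone"
  then obtain b where "\<And>t. skew_defect (V + t *\<^sub>R W) = skew_defect V + t * b"
    using skew_defect_affine_on_wave_cone by blast
  then show "convex_on UNIV (\<lambda>t. - skew_defect (V + t *\<^sub>R W))"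
    using convex_on_affine[of "- skew_defect V" "- b"] by simp
qed

lemma Lambda_hullD:
  assumes "V \<in> Lambda_hull K" "Lambda_convex f" "\<And>U. U \<in> K \<Longrightarrow> f U \<le> 0"
  shows "f V \<le> 0"
  using assms unfolding Lambda_hull_def by blast

lemma skew_defect_mhd_K: "V \<in> mhd_K \<Longrightarrow> skew_defect V = 0"
  by (auto simp: mhd_K_def skew_defect_def tensor_def mat_def)

lemma skew_defect_Lambda_hull:
  assumes "V \<in> Lambda_hull mhd_K"
  shows "skew_defect V = 0"
  using Lambda_hullD[OF assms Lambda_convex_skew_defect]
    Lambda_hullD[OF assms Lambda_convex_uminus_skew_defect]
  by (force simp: skew_defect_mhd_K)

lemma symmetric_if_in_Lambda_hull:
  assumes "(\<alpha>, \<beta>, \<alpha> \<otimes> \<beta> + N) \<in> Lambda_hull mhd_K"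
  shows "transpose N = N"
  using skew_defect_Lambda_hull[OF assms]
  by (simp add: skew_defect_def tensor_def transpose_def vec_eq_iff forall_2)

lemma interior_Lambda_hull_mhd_K: "interior (Lambda_hull mhd_K) = {}"
proof (rule ccontr)
  assume "interior (Lambda_hull mhd_K) \<noteq> {}"
  then obtain V e where e: "e > 0" "ball V e \<subseteq> Lambda_hull mhd_K"
    by (auto simp: mem_interior)
  obtain \<alpha> \<beta> M where V: "V = (\<alpha>, \<beta>, M)" by (cases V)
  \<comment> \<open>Raising the (1,2) entry of \<open>M\<close> by \<open>e/2\<close> stays in the
    ball but shifts \<open>skew_defect\<close> by \<open>e/2\<close>.\<close>
  define V' where "V' = (\<alpha>, \<beta>, M + (e/2) *\<^sub>R axis 1 (axis 2 1))"
  have "dist V V' < e"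
    using e(1) by (simp add: V V'_def dist_Pair_Pair dist_norm norm_axis_1)
  then have "skew_defect V' = 0" "skew_defect V = 0"
    using e by (auto intro!: skew_defect_Lambda_hull)
  then show False
    using e(1) by (simp add: V V'_def skew_defect_def axis_def)
qed

lemma Lambda_hull_midpoint:
  assumes "V + W \<in> K" "V - W \<in> K" "W \<in> wave_cone"
  shows "V \<in> Lambda_hull K"
  unfolding Lambda_hull_def
proof (intro CollectI allI impI)
  fix f assume f: "Lambda_convex f \<and> (\<forall>V\<in>K. f V \<le> 0)"
  then have "convex_on UNIV (\<lambda>t::real. f (V + t *\<^sub>R W))"
    using assms(3) unfolding Lambda_convex_def by blast
  \<comment> \<open>Equal weights on \<open>t = -1\<close> and \<open>t = 1\<close> give
    \<open>t = 0\<close>, that is \<open>V\<close>.\<close>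
  from convex_onD[OF this, of "1/2" "-1" 1]
  have "f V \<le> (f (V - W) + f (V + W)) / 2" by simp
  also have "\<dots> \<le> 0"
    using f assms(1,2) by (simp add: add_nonpos_nonpos)
  finally show "f V \<le> 0" .
qed

lemma Lambda_hull_mhd_K_diff: "Lambda_hull mhd_K - mhd_K \<noteq> {}"
proof -
  define e :: "real^2" where "e = axis 1 1"
  \<comment> \<open>The witness \<xi> is the second basis vector, orthogonal to \<open>e\<close>,
    with \<open>c = 0\<close>.\<close>
  have "(e, e, 0) \<in> wave_cone"
    unfolding wave_cone_def
    by (auto simp: e_def inner_vec_def sum_2 vec_eq_iff forall_2 axis_def transpose_def
        matrix_vector_mult_def intro!: exI[of _ "axis 2 1 :: real^2"] exI[of _ "0::real"])
  \<comment> \<open>Signs cancel in the tensor of \<open>-e\<close> with itself, so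
    \<open>p = 0\<close> serves both points.\<close>
  moreover have "(0, 0, e \<otimes> e) + (e, e, 0) \<in> mhd_K" "(0, 0, e \<otimes> e) - (e, e, 0) \<in> mhd_K"
    by (auto simp: mhd_K_def tensor_def vec_eq_iff intro!: exI[of _ "0::real"])
  ultimately have "(0, 0, e \<otimes> e) \<in> Lambda_hull mhd_K"
    by (intro Lambda_hull_midpoint)
  \<comment> \<open>Membership would make \<open>e \<otimes> e\<close>, which is diag(1, 0), a
    multiple of the identity.\<close>
  moreover have "(0, 0, e \<otimes> e) \<notin> mhd_K"
    by (auto simp: mhd_K_def tensor_def vec_eq_iff forall_2 e_def axis_def mat_def)
  ultimately show ?thesis by blast
qed

theorem proposition4p1:
  shows "(\<forall>(\<alpha>::real^2) (\<beta>::real^2) (N::real^2^2).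
            (\<alpha>, \<beta>, \<alpha> \<otimes> \<beta> + N) \<in> Lambda_hull mhd_K \<longrightarrow> transpose N = N) \<and>
         interior (Lambda_hull mhd_K) = {} \<and>
         Lambda_hull mhd_K - mhd_K \<noteq> {}"
  using symmetric_if_in_Lambda_hull interior_Lambda_hull_mhd_K Lambda_hull_mhd_K_diff by blast

end
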